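(* Let $G$ be a finite abelian group of odd order such that $\mathsf D(G)=\mathsf D^*(G)\ge3$, and let $k=\ell\,\mathsf D(G)+j\ge2$, where $\ell\in\mathbb N_0$ and $j\in[0,\mathsf d(G)]$. Then $$\mathcal U_k\bigl(\mathcal B_\pm(G)\bigr)=\begin{cases}[2,\lfloor k\mathsf D(G)/2\rfloor],&\text{if }j\in[2,\mathsf d(G)]\text{ and }\ell=0;\\ [2\ell,\lfloor k\mathsf D(G)/2\rfloor],&\text{if }j=0\text{ and }\ell\ge1;\\ [2\ell+1,\lfloor k\mathsf D(G)/2\rfloor],&\text{if }j\in[1,\mathsf d(G)/2]\text{ and }\ell\ge1;\\ [2\ell+2,\lfloor k\mathsf D(G)/2\rfloor],&\text{if }j\in[1+\mathsf d(G)/2,\mathsf d(G)]\text{ and }\ell\ge1.\end{cases}$$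
   Context: Intervals are discrete: $[a,b]=\{x\in\mathbb Z:a\le x\le b\}$. $G$ is written additively and $\mathcal F(G)$ is the (multiplicative) free abelian monoid with basis $G$; its elements are called sequences, and $|S|$ is the length of $S$. $\mathcal B_\pm(G)=\{g_1\cdot\ldots\cdot g_\ell\in\mathcal F(G):\ \ell\ge0,\ \varepsilon_1g_1+\dots+\varepsilon_\ell g_\ell=0\text{ for some }\varepsilon_i\in\{1,-1\}\}$ and $\mathcal B(G)=\{g_1\cdot\ldots\cdot g_\ell\in\mathcal F(G):g_1+\dots+g_\ell=0\}$. $\mathsf D(G)$ is the (usual) Davenport constant: the maximal length of an atom (irreducible element) of $\mathcal B(G)$. $\mathsf d(G)$ is the maximal length of a zero-sum free sequence over $G$ (a sequence no nonempty subsequence of which has sum $0$); $\mathsf D(G)=1+\mathsf d(G)$. If $G\cong C_{n_1}\oplus\dots\oplus C_{n_r}$ with $1<n_1\mid\dots\mid n_r$, then $\mathsf D^*(G)=1+\sum_{i=1}^r(n_i-1)$. For a reduced monoid $H$ with all elements having finitely many factorization lengths, the set of lengths $\mathsf L(a)$ of $a\in H$ is the set of all $k\in\mathbb N_0$ such that $a$ is a product of $k$ atoms; $\mathcal L(H)=\{\mathsf L(a):a\in H\}$; and $\mathcal U_k(H)=\bigcup_{L\in\mathcal L(H),\,k\in L}L$. *)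

theory Defs
  imports "HOL-Algebra.Algebra" "HOL-Library.Multiset" Complex_Main
begin

text \<open>Sequences over an additive group \<open>G = UNIV :: 'a set\<close> are finite multisets over \<open>'a\<close>,
  concatenation of sequences is multiset addition, and the length of a sequence is its size.\<close>

definition sequence_monoid :: "'a multiset set \<Rightarrow> 'a multiset monoid" where
  "sequence_monoid M = \<lparr>carrier = M, monoid.mult = (+), one = {#}\<rparr>"

definition zero_sum_monoid :: "'a::ab_group_add multiset monoid" where
  "zero_sum_monoid = sequence_monoid {S. \<Sum>\<^sub># S = 0}"

definition pm_zero_sum_monoid :: "'a::ab_group_add multiset monoid" where
  "pm_zero_sum_monoid = sequence_monoid
     {mset gs | gs. \<exists>\<epsilon> :: nat \<Rightarrow> int. (\<forall>i < length gs. \<epsilon> i \<in> {1, -1}) \<and>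
        (\<Sum>i < length gs. if \<epsilon> i = 1 then gs ! i else - (gs ! i)) = 0}"

text \<open>\<open>irreducible\<close> does not itself require membership in the carrier. In a reduced cancellative
  commutative monoid it amounts to: not the identity and not a product of two non-identity elements.\<close>

definition atoms :: "('b, 'm) monoid_scheme \<Rightarrow> 'b set" where
  "atoms H = {a \<in> carrier H. irreducible H a}"

definition length_set :: "('b, 'm) monoid_scheme \<Rightarrow> 'b \<Rightarrow> nat set" where
  "length_set H a = {length as | as. set as \<subseteq> atoms H \<and> factors H as a}"

definition length_system :: "('b, 'm) monoid_scheme \<Rightarrow> nat set set" where
  "length_system H = {length_set H a | a. a \<in> carrier H}"

definition length_union :: "nat \<Rightarrow> ('b, 'm) monoid_scheme \<Rightarrow> nat set" where
  "length_union k H = \<Union> {L \<in> length_system H. k \<in> L}"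

text \<open>For a finite group the sets below are finite and nonempty, so that \<open>Max\<close> is meaningful.\<close>

definition davenport :: "'a::{ab_group_add, finite} itself \<Rightarrow> nat" where
  "davenport _ = Max (size ` atoms (zero_sum_monoid :: 'a multiset monoid))"

definition zero_sum_free :: "'a::ab_group_add multiset \<Rightarrow> bool" where
  "zero_sum_free S \<longleftrightarrow> (\<forall>T. T \<subseteq># S \<and> T \<noteq> {#} \<longrightarrow> \<Sum>\<^sub># T \<noteq> 0)"

definition small_davenport :: "'a::{ab_group_add, finite} itself \<Rightarrow> nat" where
  "small_davenport _ = Max {size S | S :: 'a multiset. zero_sum_free S}"

definition additive_group :: "'a::ab_group_add monoid" where
  "additive_group = \<lparr>carrier = UNIV, monoid.mult = (+), one = 0\<rparr>"

definition invariant_factors :: "'a::{ab_group_add, finite} itself \<Rightarrow> nat list \<Rightarrow> bool" where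
  "invariant_factors _ ns \<longleftrightarrow>
     (\<forall>n \<in> set ns. 1 < n) \<and> sorted_wrt (dvd) ns \<and>
     (additive_group :: 'a monoid) \<cong>
       product_group {..<length ns} (\<lambda>i. integer_mod_group (ns ! i))"

text \<open>By the structure theorem for finite abelian groups there is exactly one list of invariant
  factors, so the following set is a singleton and \<open>Sup\<close> just selects its element.\<close>

definition davenport_star :: "'a::{ab_group_add, finite} itself \<Rightarrow> nat" where
  "davenport_star G = Sup {1 + (\<Sum>n\<leftarrow>ns. n - 1) | ns. invariant_factors G ns}"

end

theory Submission imports Defs begin

text \<open>
  Write \<open>D\<close> for the Davenport constant and call \<open>m\<close> and \<open>k\<close> linked if some element has
  factorizations of both lengths. The four cases of the theorem are readings of one symmetric
  criterion, \<open>length_union_pm_zero_sum_monoid\<close>: for \<open>k \<ge> 2\<close>, the numbers \<open>k\<close> and \<open>m\<close> are linked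
  if and only if \<open>m \<ge> 2\<close>, \<open>2 m \<le> k D\<close> and \<open>2 k \<le> m D\<close>. For \<open>k = l D + j\<close> the smallest such \<open>m\<close>
  is the ceiling of \<open>2 l + 2 j / D\<close>, or 2 if that is larger.

  Necessity comes from the size of atoms. Flipping the signs of some terms turns an atom of
  \<open>B\<^sub>\<plusminus>(G)\<close> into an atom of \<open>B(G)\<close>, so atoms have at most \<open>D\<close> terms; and every atom except the
  sequence \<open>0\<close> has at least two. Counting terms, with \<open>0\<close> counted twice, gives both
  inequalities (\<open>length_set_bounds\<close>).

  For sufficiency, linkedness is symmetric and additive, so it is enough to link 2 with
  \<open>2, \<dots>, D\<close> and 3 with every \<open>n\<close> satisfying \<open>3 \<le> n \<le> 3 D / 2\<close>. Three facts do this.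

  \<^item> If \<open>G\<close> has invariant factors \<open>n\<^sub>1, \<dots>, n\<^sub>r\<close>, all odd, and basis \<open>b\<^sub>1, \<dots>, b\<^sub>r\<close>, then the product of
    \<open>e = b\<^sub>1 + \<dots> + b\<^sub>r\<close> and all \<open>b\<^sub>i\<close> with multiplicity \<open>n\<^sub>i - 1\<close> is an atom \<open>U\<close>
    (\<open>coordinates_pm_atom\<close>). It has \<open>D\<close> terms since \<open>D = 1 + (n\<^sub>1 - 1) + \<dots> + (n\<^sub>r - 1)\<close> by assumption. As \<open>n\<^sub>i - 1\<close> is even, \<open>U\<close> has the form \<open>e W W\<close>.

  \<^item> Two terms \<open>g, h\<close> of an atom can be replaced by \<open>g + h\<close> or \<open>g - h\<close> so that it stays an atom
    (\<open>pm_atom_merge\<close>). Hence there are atoms \<open>V\<close> with any number of terms between 2 and \<open>D\<close> that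
    contain \<open>e\<close>. The square \<open>V V\<close> is also a product of the atoms \<open>g g\<close> for the terms \<open>g\<close> of \<open>V\<close>,
    which links 2 with the size of \<open>V\<close>.

  \<^item> Let \<open>U'\<close> arise from \<open>U\<close> by doubling all terms, and let \<open>V = e T\<close> be an atom. In \<open>V V U'\<close> all
    terms pair off into squares except for \<open>e\<close>, \<open>e\<close>, \<open>e + e\<close>, and these three form an atom.
    This links 3 with \<open>1 + |T| + |W|\<close>, which reaches \<open>(3 D - 1) / 2\<close>; the smaller values come
    from linking 2 with \<open>2, \<dots>, D\<close> and adding the atom \<open>0\<close>.
\<close>

section \<open>Plus-minus weighted zero-sum sequences\<close>

lemma atoms_sequence_monoid:
  assumes "{#} \<in> M" and "\<And>B C. B \<in> M \<Longrightarrow> C \<in> M \<Longrightarrow> B + C \<in> M"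
  shows "A \<in> atoms (sequence_monoid M) \<longleftrightarrow>
    A \<in> M \<and> A \<noteq> {#} \<and> (\<forall>B\<in>M. \<forall>C\<in>M. A = B + C \<longrightarrow> B = {#} \<or> C = {#})"
proof -
  have U: "Units (sequence_monoid M) = {{#}}"
    using assms(1) by (auto simp: Units_def sequence_monoid_def)
  have P: "properfactor (sequence_monoid M) B A \<longleftrightarrow> (\<exists>C\<in>M. A = B + C \<and> C \<noteq> {#})"
    if "B \<in> M" "A \<in> M" for B
    using that assms(1) by (force simp: properfactor_def factor_def sequence_monoid_def add.assoc)
  have C: "carrier (sequence_monoid M) = M"
    by (simp add: sequence_monoid_def)
  show ?thesis
    unfolding atoms_def irreducible_def U C using P by auto
qed

lemma length_set_sequence_monoid:
  "n \<in> length_set (sequence_monoid M) A \<longleftrightarrow>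
    (\<exists>as. length as = n \<and> set as \<subseteq> atoms (sequence_monoid M) \<and> sum_list as = A)"
proof -
  have "factors (sequence_monoid M) as A \<longleftrightarrow> sum_list as = A"
    if "set as \<subseteq> atoms (sequence_monoid M)" for as
    using that by (auto simp: factors_def atoms_def sequence_monoid_def sum_list.eq_foldr)
  then show ?thesis
    unfolding length_set_def by auto
qed

text \<open>Splitting the sequence into the terms with sign plus and those with sign minus avoids an
  indexed family of signs, so that membership can be computed term by term.\<close>

definition signed_sums :: "'a::ab_group_add multiset \<Rightarrow> 'a set" where
  "signed_sums S = {\<Sum>\<^sub># A - \<Sum>\<^sub># B | A B. S = A + B}"

lemma signed_sums_empty [simp]: "signed_sums {#} = {0}"
  by (auto simp: signed_sums_def)

lemma signed_sums_add_mset: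
  "x \<in> signed_sums (add_mset g S) \<longleftrightarrow> x - g \<in> signed_sums S \<or> x + g \<in> signed_sums S"
proof
  assume "x \<in> signed_sums (add_mset g S)"
  then obtain A B where AB: "add_mset g S = A + B" "x = \<Sum>\<^sub># A - \<Sum>\<^sub># B"
    by (auto simp: signed_sums_def)
  from AB(1) have "g \<in># A \<or> g \<in># B"
    by (metis union_iff union_single_eq_member)
  then show "x - g \<in> signed_sums S \<or> x + g \<in> signed_sums S"
  proof
    assume "g \<in># A"
    then obtain A' where "A = add_mset g A'" by (meson multi_member_split)
    with AB have "S = A' + B" "x - g = \<Sum>\<^sub># A' - \<Sum>\<^sub># B" by auto
    then show ?thesis by (auto simp: signed_sums_def)
  next
    assume "g \<in># B"
    then obtain B' where "B = add_mset g B'" by (meson multi_member_split)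
    with AB have "S = A + B'" "x + g = \<Sum>\<^sub># A - \<Sum>\<^sub># B'" by auto
    then show ?thesis by (auto simp: signed_sums_def)
  qed
next
  assume "x - g \<in> signed_sums S \<or> x + g \<in> signed_sums S"
  then obtain A B where AB: "S = A + B" "x - g = \<Sum>\<^sub># A - \<Sum>\<^sub># B \<or> x + g = \<Sum>\<^sub># A - \<Sum>\<^sub># B"
    by (auto simp: signed_sums_def)
  then have "x = \<Sum>\<^sub># (add_mset g A) - \<Sum>\<^sub># B \<or> x = \<Sum>\<^sub># A - \<Sum>\<^sub># (add_mset g B)"
    by (auto simp: algebra_simps)
  moreover have "add_mset g S = add_mset g A + B" "add_mset g S = A + add_mset g B"
    using AB(1) by auto
  ultimately show "x \<in> signed_sums (add_mset g S)"
    unfolding signed_sums_def by blast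
qed

lemma signed_sums_mset:
  "x \<in> signed_sums (mset gs) \<longleftrightarrow>
    (\<exists>\<epsilon> :: nat \<Rightarrow> int. (\<forall>i < length gs. \<epsilon> i \<in> {1, -1}) \<and>
      (\<Sum>i < length gs. if \<epsilon> i = 1 then gs ! i else - (gs ! i)) = x)"
proof (induction gs arbitrary: x)
  case Nil
  then show ?case by auto
next
  case (Cons g gs)
  let ?s = "\<lambda>gs \<epsilon>. \<Sum>i < length gs. if (\<epsilon> :: nat \<Rightarrow> int) i = 1 then gs ! i else - (gs ! i)"
  have shift: "?s (g # gs) \<epsilon> = (if \<epsilon> 0 = 1 then g else - g) + ?s gs (\<lambda>i. \<epsilon> (Suc i))" for \<epsilon>
    by (simp add: sum.lessThan_Suc_shift del: sum.lessThan_Suc cong: if_cong)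
  show ?case
  proof
    assume "x \<in> signed_sums (mset (g # gs))"
    then obtain s :: int where s: "s \<in> {1, -1}" "x - (if s = 1 then g else - g) \<in> signed_sums (mset gs)"
      by (force simp: signed_sums_add_mset)
    then obtain \<epsilon> :: "nat \<Rightarrow> int" where \<epsilon>: "\<forall>i < length gs. \<epsilon> i \<in> {1, -1}"
        "?s gs \<epsilon> = x - (if s = 1 then g else - g)"
      using Cons.IH by blast
    let ?\<epsilon> = "case_nat s \<epsilon>"
    have "\<forall>i < length (g # gs). ?\<epsilon> i \<in> {1, -1}"
      using s(1) \<epsilon>(1) by (auto split: nat.splits)
    moreover have "?s (g # gs) ?\<epsilon> = x"
      unfolding shift using \<epsilon>(2) by simp
    ultimately show "\<exists>\<epsilon>. (\<forall>i < length (g # gs). \<epsilon> i \<in> {1, -1}) \<and> ?s (g # gs) \<epsilon> = x"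
      by blast
  next
    assume "\<exists>\<epsilon>. (\<forall>i < length (g # gs). \<epsilon> i \<in> {1, -1}) \<and> ?s (g # gs) \<epsilon> = x"
    then obtain \<epsilon> :: "nat \<Rightarrow> int" where \<epsilon>: "\<forall>i < length (g # gs). \<epsilon> i \<in> {1, -1}" "?s (g # gs) \<epsilon> = x"
      by blast
    have "\<forall>i < length gs. \<epsilon> (Suc i) \<in> {1, -1}"
      using \<epsilon>(1) by auto
    moreover have "?s gs (\<lambda>i. \<epsilon> (Suc i)) = x - (if \<epsilon> 0 = 1 then g else - g)"
      using \<epsilon>(2) unfolding shift by (simp add: algebra_simps)
    ultimately have "x - (if \<epsilon> 0 = 1 then g else - g) \<in> signed_sums (mset gs)"
      unfolding Cons.IH by (intro exI[of _ "\<lambda>i. \<epsilon> (Suc i)"]) blast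
    then show "x \<in> signed_sums (mset (g # gs))"
      by (auto simp: signed_sums_add_mset split: if_splits)
  qed
qed

lemma pm_zero_sum_monoid_eq: "pm_zero_sum_monoid = sequence_monoid {S. 0 \<in> signed_sums S}"
proof -
  have "{mset gs | gs. \<exists>\<epsilon> :: nat \<Rightarrow> int. (\<forall>i < length gs. \<epsilon> i \<in> {1, -1}) \<and>
        (\<Sum>i < length gs. if \<epsilon> i = 1 then gs ! i else - (gs ! i)) = 0} = {S. (0::'a) \<in> signed_sums S}"
    unfolding signed_sums_mset[symmetric] by (auto intro: ex_mset[THEN exE]) (metis ex_mset)
  then show ?thesis
    unfolding pm_zero_sum_monoid_def by simp
qed

lemma signed_sums_union:
  assumes "x \<in> signed_sums S" and "y \<in> signed_sums T"
  shows "x + y \<in> signed_sums (S + T)"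
proof -
  from assms obtain A B C E where "S = A + B" "x = \<Sum>\<^sub># A - \<Sum>\<^sub># B" "T = C + E" "y = \<Sum>\<^sub># C - \<Sum>\<^sub># E"
    by (auto simp: signed_sums_def)
  then have "S + T = (A + C) + (B + E)" "x + y = \<Sum>\<^sub># (A + C) - \<Sum>\<^sub># (B + E)"
    by (auto simp: ac_simps algebra_simps)
  then show ?thesis unfolding signed_sums_def by blast
qed

lemma zero_signed_sums_union:
  "0 \<in> signed_sums S \<Longrightarrow> 0 \<in> signed_sums T \<Longrightarrow> 0 \<in> signed_sums (S + T)"
  using signed_sums_union[of 0 S 0 T] by simp

lemma pm_atom_iff:
  "A \<in> atoms pm_zero_sum_monoid \<longleftrightarrow> 0 \<in> signed_sums A \<and> A \<noteq> {#} \<and>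
    (\<forall>B C. 0 \<in> signed_sums B \<and> 0 \<in> signed_sums C \<and> A = B + C \<longrightarrow> B = {#} \<or> C = {#})"
  unfolding pm_zero_sum_monoid_eq
  by (subst atoms_sequence_monoid) (auto intro: zero_signed_sums_union)

lemma zero_sum_atom_iff:
  "A \<in> atoms zero_sum_monoid \<longleftrightarrow> \<Sum>\<^sub># A = 0 \<and> A \<noteq> {#} \<and>
    (\<forall>B C. \<Sum>\<^sub># B = 0 \<and> \<Sum>\<^sub># C = 0 \<and> A = B + C \<longrightarrow> B = {#} \<or> C = {#})"
  unfolding zero_sum_monoid_def
  by (subst atoms_sequence_monoid) auto

lemma pm_atomD:
  assumes "A \<in> atoms pm_zero_sum_monoid"
  shows "0 \<in> signed_sums A" and "A \<noteq> {#}"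
    and "\<lbrakk>0 \<in> signed_sums B; 0 \<in> signed_sums C; A = B + C\<rbrakk> \<Longrightarrow> B = {#} \<or> C = {#}"
  using assms unfolding pm_atom_iff by blast+

lemma pm_atomI:
  assumes "0 \<in> signed_sums A" and "A \<noteq> {#}"
    and "\<And>B C. \<lbrakk>0 \<in> signed_sums B; 0 \<in> signed_sums C; A = B + C\<rbrakk> \<Longrightarrow> B = {#} \<or> C = {#}"
  shows "A \<in> atoms pm_zero_sum_monoid"
  using assms unfolding pm_atom_iff by blast

lemma zero_sum_atomD:
  assumes "A \<in> atoms zero_sum_monoid"
  shows "\<Sum>\<^sub># A = 0" and "A \<noteq> {#}"
    and "\<lbrakk>\<Sum>\<^sub># B = 0; \<Sum>\<^sub># C = 0; A = B + C\<rbrakk> \<Longrightarrow> B = {#} \<or> C = {#}"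
  using assms unfolding zero_sum_atom_iff by blast+

lemma zero_sum_atomI:
  assumes "\<Sum>\<^sub># A = 0" and "A \<noteq> {#}"
    and "\<And>B C. \<lbrakk>\<Sum>\<^sub># B = 0; \<Sum>\<^sub># C = 0; A = B + C\<rbrakk> \<Longrightarrow> B = {#} \<or> C = {#}"
  shows "A \<in> atoms zero_sum_monoid"
  using assms unfolding zero_sum_atom_iff by blast

section \<open>Davenport constants\<close>

lemma zero_sum_atom_add_mset_iff:
  "add_mset g S \<in> atoms zero_sum_monoid \<longleftrightarrow> zero_sum_free S \<and> g = - \<Sum>\<^sub># S"
proof
  assume A: "add_mset g S \<in> atoms zero_sum_monoid"
  have s: "g + \<Sum>\<^sub># S = 0" using zero_sum_atomD(1)[OF A] by simp
  have "\<Sum>\<^sub># T \<noteq> 0" if "T \<subseteq># S" "T \<noteq> {#}" for T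
  proof
    assume T: "\<Sum>\<^sub># T = 0"
    from that(1) obtain R where R: "S = T + R" unfolding mset_subset_eq_exists_conv by blast
    have eq: "add_mset g S = T + add_mset g R" by (simp add: R)
    have "\<Sum>\<^sub># (add_mset g R) = 0" using s T unfolding R by simp
    then show False using zero_sum_atomD(3)[OF A T _ eq] that(2) by simp
  qed
  then show "zero_sum_free S \<and> g = - \<Sum>\<^sub># S"
    using s by (auto simp: zero_sum_free_def eq_neg_iff_add_eq_0)
next
  assume S: "zero_sum_free S \<and> g = - \<Sum>\<^sub># S"
  have "B = {#} \<or> C = {#}" if "\<Sum>\<^sub># B = 0" "\<Sum>\<^sub># C = 0" "add_mset g S = B + C" for B C
  proof -
    have "B \<subseteq># S \<or> C \<subseteq># S"
    proof (cases "g \<in># B")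
      case True
      then obtain B' where "B = add_mset g B'" by (meson multi_member_split)
      then show ?thesis using that(3) by simp
    next
      case False
      then have "g \<in># C" using that(3) by (metis union_iff union_single_eq_member)
      then obtain C' where "C = add_mset g C'" by (meson multi_member_split)
      then show ?thesis using that(3) by simp
    qed
    then show ?thesis using S that(1,2) by (auto simp: zero_sum_free_def)
  qed
  then show "add_mset g S \<in> atoms zero_sum_monoid"
    using S by (intro zero_sum_atomI) auto
qed

text \<open>By the pigeonhole principle: if two of the partial sums of an enumeration agree, the segment
  between them sums to zero.\<close>

lemma zero_sum_free_size:
  fixes S :: "'a::{ab_group_add, finite} multiset"
  assumes "zero_sum_free S"
  shows "size S < card (UNIV :: 'a set)"
proof -
  obtain xs where xs: "mset xs = S" by (metis ex_mset)
  have neq: "sum_list (take i xs) \<noteq> sum_list (take j xs)" if "i < j" "j \<le> length xs" for i j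
  proof
    assume eq: "sum_list (take i xs) = sum_list (take j xs)"
    define ys where "ys = drop i (take j xs)"
    have tj: "take j xs = take i xs @ ys"
      using that by (metis append_take_drop_id min.absorb1 less_imp_le take_take ys_def)
    have "xs = take i xs @ ys @ drop j xs"
      using tj by (metis append.assoc append_take_drop_id)
    then have "mset xs = mset ys + (mset (take i xs) + mset (drop j xs))"
      by (metis mset_append union_assoc union_commute)
    then have "mset ys \<subseteq># S" using xs by (metis mset_subset_eq_add_left)
    moreover have "mset ys \<noteq> {#}" using that by (simp add: ys_def)
    moreover have "\<Sum>\<^sub># (mset ys) = 0"
      using eq unfolding tj by (simp add: sum_mset_sum_list)
    ultimately show False using assms by (auto simp: zero_sum_free_def)
  qed
  have "inj_on (\<lambda>i. sum_list (take i xs)) {..length xs}"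
    by (rule linorder_inj_onI) (use neq in auto)
  then have "card {..length xs} \<le> card (UNIV :: 'a set)"
    by (rule card_inj_on_le) auto
  then show ?thesis using xs by auto
qed

lemma finite_zero_sum_free_sizes: "finite {size S | S :: 'a::{ab_group_add, finite} multiset. zero_sum_free S}"
  by (rule finite_subset[of _ "{..card (UNIV :: 'a set)}"]) (auto dest: zero_sum_free_size)

lemma zero_sum_atom_sizes:
  "size ` atoms (zero_sum_monoid :: 'a::ab_group_add multiset monoid) =
    Suc ` {size S | S :: 'a multiset. zero_sum_free S}"
  (is "_ = Suc ` ?F")
proof (rule Set.set_eqI)
  fix n
  have "n \<in> size ` atoms (zero_sum_monoid :: 'a multiset monoid) \<longleftrightarrow>
      (\<exists>g S. add_mset g S \<in> atoms (zero_sum_monoid :: 'a multiset monoid) \<and> n = Suc (size S))"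
    by (metis (no_types, lifting) image_iff multiset_cases size_add_mset zero_sum_atomD(2))
  also have "\<dots> \<longleftrightarrow> n \<in> Suc ` ?F"
    by (auto simp: zero_sum_atom_add_mset_iff)
  finally show "n \<in> size ` atoms (zero_sum_monoid :: 'a multiset monoid) \<longleftrightarrow> n \<in> Suc ` ?F" .
qed

text \<open>Removing a term from an atom leaves a zero-sum free sequence, and appending the negative of its
  sum to a zero-sum free sequence gives an atom.\<close>

lemma davenport_eq_Suc_small_davenport:
  "davenport TYPE('a::{ab_group_add, finite}) = Suc (small_davenport TYPE('a))"
proof -
  have "zero_sum_free ({#} :: 'a multiset)" by (simp add: zero_sum_free_def)
  then have "{size S | S :: 'a multiset. zero_sum_free S} \<noteq> {}" by blast
  then show ?thesis
    unfolding davenport_def small_davenport_def zero_sum_atom_sizes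
    by (rule mono_Max_commute[OF mono_Suc finite_zero_sum_free_sizes, symmetric])
qed

lemma size_le_davenport:
  fixes A :: "'a::{ab_group_add, finite} multiset"
  assumes "A \<in> atoms zero_sum_monoid"
  shows "size A \<le> davenport TYPE('a)"
  unfolding davenport_def
proof (rule Max_ge)
  show "finite (size ` atoms (zero_sum_monoid :: 'a multiset monoid))"
    unfolding zero_sum_atom_sizes by (intro finite_imageI finite_zero_sum_free_sizes)
qed (use assms in simp)

text \<open>The negative terms of a vanishing signed sum are replaced by their inverses. A decomposition of
  the resulting zero-sum sequence carries over to the given one when these terms are flipped back.\<close>

lemma pm_atom_lift:
  fixes A :: "'a::ab_group_add multiset"
  assumes "A \<in> atoms pm_zero_sum_monoid"
  obtains T :: "'a multiset" where "T \<in> atoms zero_sum_monoid" and "size T = size A"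
proof -
  from assms obtain P Q where PQ: "A = P + Q" "\<Sum>\<^sub># P - \<Sum>\<^sub># Q = 0"
    using pm_atomD(1)[of A] unfolding signed_sums_def by auto
  define N where "N = image_mset uminus Q"
  have sum_neg: "\<Sum>\<^sub># (image_mset uminus Y) = - \<Sum>\<^sub># Y" for Y :: "'a multiset"
    by (induction Y) auto
  have pm: "0 \<in> signed_sums (P' + image_mset uminus N')" if "\<Sum>\<^sub># (P' + N') = 0" for P' N' :: "'a multiset"
    unfolding signed_sums_def using that
    by (intro CollectI exI[of _ P'] exI[of _ "image_mset uminus N'"]) (simp add: sum_neg)
  have "B = {#} \<or> C = {#}" if BC: "\<Sum>\<^sub># B = 0" "\<Sum>\<^sub># C = 0" "P + N = B + C" for B C
  proof -
    (* B and C are each split into their parts inside P and inside N. *)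
    define P1 where "P1 = P \<inter># B"
    define N1 where "N1 = B - P"
    have B: "B = P1 + N1" by (auto simp: P1_def N1_def multiset_eq_iff min_def)
    have "N1 \<subseteq># N" using BC(3) by (simp add: N1_def subset_eq_diff_conv add.commute)
    then obtain N2 where N: "N = N1 + N2" unfolding mset_subset_eq_exists_conv by blast
    have "P1 \<subseteq># P" by (simp add: P1_def)
    then obtain P2 where P: "P = P1 + P2" unfolding mset_subset_eq_exists_conv by blast
    have C: "C = P2 + N2" using BC(3) unfolding B N P by (simp add: ac_simps)
    have "Q = image_mset uminus N" by (simp add: N_def image_mset.compositionality o_def)
    then have "A = (P1 + image_mset uminus N1) + (P2 + image_mset uminus N2)"
      unfolding PQ(1) P N by (simp add: ac_simps)
    moreover have "0 \<in> signed_sums (P1 + image_mset uminus N1)" "0 \<in> signed_sums (P2 + image_mset uminus N2)"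
      using pm BC(1,2) unfolding B C by blast+
    ultimately have "P1 + image_mset uminus N1 = {#} \<or> P2 + image_mset uminus N2 = {#}"
      using pm_atomD(3)[OF assms] by metis
    then show ?thesis unfolding B C by auto
  qed
  moreover have "\<Sum>\<^sub># (P + N) = 0" "P + N \<noteq> {#}"
    using PQ pm_atomD(2)[OF assms] by (auto simp: N_def sum_neg)
  ultimately have "P + N \<in> atoms zero_sum_monoid" by (intro zero_sum_atomI)
  then show thesis by (rule that) (simp add: N_def PQ(1))
qed

lemma pm_atom_size_le_davenport:
  fixes A :: "'a::{ab_group_add, finite} multiset"
  assumes "A \<in> atoms pm_zero_sum_monoid"
  shows "size A \<le> davenport TYPE('a)"
  using pm_atom_lift[OF assms] size_le_davenport by metis

section \<open>Short atoms\<close>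

lemma zero_pm_atom: "{#0#} \<in> atoms pm_zero_sum_monoid"
proof -
  have "B = {#} \<or> C = {#}" if "{#0::'a#} = B + C" for B C
    using arg_cong[OF that, of size] by (cases B; cases C) auto
  then show ?thesis
    by (intro pm_atomI) (auto simp: signed_sums_add_mset)
qed

lemma pm_atom_with_zero:
  assumes "A \<in> atoms pm_zero_sum_monoid" and "0 \<in># A"
  shows "A = {#0#}"
proof -
  obtain S where S: "A = {#0#} + S" using assms(2) by (metis mset_add add_mset_add_single union_commute)
  have "0 \<in> signed_sums S" using pm_atomD(1)[OF assms(1)] unfolding S by (auto simp: signed_sums_add_mset)
  then have "S = {#}" using pm_atomD(3)[OF assms(1) _ _ S] by (simp add: signed_sums_add_mset)
  then show ?thesis using S by simp
qed

text \<open>Consequently a sequence of at most three nonzero terms cannot be split into two nonempty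
  sequences with vanishing signed sums.\<close>

lemma zero_signed_sums_size_ge_2:
  assumes "0 \<in> signed_sums A" and "A \<noteq> {#}" and "0 \<notin># A"
  shows "2 \<le> size A"
proof (rule ccontr)
  assume "\<not> 2 \<le> size A"
  moreover have "size A \<noteq> 0" using assms(2) by simp
  ultimately have "size A = 1" by linarith
  then obtain g where "A = {#g#}" using size_1_singleton_mset by blast
  then show False using assms by (auto simp: signed_sums_add_mset)
qed

lemma pm_atomI_size_le_3:
  assumes "0 \<in> signed_sums A" and "A \<noteq> {#}" and "0 \<notin># A" and "size A \<le> 3"
  shows "A \<in> atoms pm_zero_sum_monoid"
proof -
  have "B = {#} \<or> C = {#}" if "0 \<in> signed_sums B" "0 \<in> signed_sums C" "A = B + C" for B C
  proof (rule ccontr)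
    assume "\<not> (B = {#} \<or> C = {#})"
    then have "2 \<le> size B" "2 \<le> size C"
      using that assms(3) by (auto intro!: zero_signed_sums_size_ge_2)
    then show False using assms(4) that(3) by simp
  qed
  then show ?thesis using assms(1,2) by (intro pm_atomI)
qed

text \<open>In a vanishing signed sum, \<open>g\<close> and \<open>h\<close> occur with equal or opposite signs; up to sign, their
  contribution is that of the single term \<open>f = g + h\<close> or \<open>f = g - h\<close>. Conversely \<open>f\<close> can always be
  expanded back into \<open>g\<close> and \<open>h\<close>, so a decomposition of the merged sequence would yield one of the
  original atom.\<close>

lemma pm_atom_merge:
  assumes "add_mset g (add_mset h S) \<in> atoms pm_zero_sum_monoid"
  shows "\<exists>f. add_mset f S \<in> atoms pm_zero_sum_monoid"
proof -
  have "0 \<in> signed_sums (add_mset g (add_mset h S))"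
    using assms by (rule pm_atomD)
  then have "0 \<in> signed_sums (add_mset (g + h) S) \<or> 0 \<in> signed_sums (add_mset (g - h) S)"
    by (auto simp: signed_sums_add_mset algebra_simps)
  then obtain f where f: "f = g + h \<or> f = g - h" "0 \<in> signed_sums (add_mset f S)"
    by blast
  have unmerge: "0 \<in> signed_sums (add_mset g (add_mset h B))" if "0 \<in> signed_sums (add_mset f B)" for B
    using f(1) that by (auto simp: signed_sums_add_mset algebra_simps)
  have key: "C = {#}" if "0 \<in> signed_sums B" "0 \<in> signed_sums C" "add_mset f S = B + C" "f \<in># B" for B C
  proof -
    obtain B' where B': "B = add_mset f B'" using \<open>f \<in># B\<close> by (meson multi_member_split)
    have eq: "add_mset g (add_mset h S) = add_mset g (add_mset h B') + C"
      using that(3) B' by simp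
    have "0 \<in> signed_sums (add_mset g (add_mset h B'))"
      using that(1) B' unmerge by blast
    then show ?thesis
      using pm_atomD(3)[OF assms _ _ eq] that(2) by simp
  qed
  have "B = {#} \<or> C = {#}" if "0 \<in> signed_sums B" "0 \<in> signed_sums C" "add_mset f S = B + C" for B C
  proof -
    have "f \<in># B \<or> f \<in># C" using that(3) by (metis union_iff union_single_eq_member)
    then show ?thesis using key[of B C] key[of C B] that by (auto simp: union_commute)
  qed
  then show ?thesis using pm_atomI[OF f(2)] by (metis add_mset_not_empty)
qed

text \<open>Terms other than \<open>e\<close> are merged one pair at a time.\<close>

lemma pm_atoms_of_smaller_size:
  assumes "add_mset e S \<in> atoms pm_zero_sum_monoid" and "1 \<le> t" and "t \<le> size S"
  shows "\<exists>T. size T = t \<and> add_mset e T \<in> atoms pm_zero_sum_monoid"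
  using assms(3,2)
proof (induction rule: inc_induct)
  case base
  then show ?case using assms(1) by blast
next
  case (step n)
  then obtain T where T: "size T = Suc n" "add_mset e T \<in> atoms pm_zero_sum_monoid" by auto
  obtain g T' where T': "T = add_mset g T'" "size T' = n" using T(1) by (metis size_eq_Suc_imp_eq_union size_add_mset nat.inject)
  obtain h R where R: "T' = add_mset h R" using T'(2) step.prems
    by (metis multiset_cases size_empty not_one_le_zero)
  have "add_mset g (add_mset h (add_mset e R)) \<in> atoms pm_zero_sum_monoid"
    using T(2) T'(1) R by (simp add: add_mset_commute)
  then obtain f where "add_mset f (add_mset e R) \<in> atoms pm_zero_sum_monoid"
    using pm_atom_merge by blast
  then show ?case using T'(2) R
    by (intro exI[of _ "add_mset f R"]) (simp add: add_mset_commute)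
qed

section \<open>An atom of maximal length\<close>

lemma group_additive_group: "group (additive_group :: 'a::ab_group_add monoid)"
proof (rule groupI)
  fix x :: 'a
  show "\<exists>y\<in>carrier additive_group. y \<otimes>\<^bsub>additive_group\<^esub> x = \<one>\<^bsub>additive_group\<^esub>"
    by (rule bexI[of _ "- x"]) (auto simp: additive_group_def)
qed (auto simp: additive_group_def add.assoc)

text \<open>The order of \<open>x\<close> divides both 2 and the odd group order.\<close>

lemma odd_card_double_eq_0:
  fixes x :: "'a::{ab_group_add, finite}"
  assumes "odd (card (UNIV :: 'a set))" and "x + x = 0"
  shows "x = 0"
proof -
  interpret group "additive_group :: 'a monoid" by (rule group_additive_group)
  have carr: "carrier (additive_group :: 'a monoid) = UNIV" by (simp add: additive_group_def)
  have "x [^]\<^bsub>additive_group\<^esub> (2::nat) = \<one>\<^bsub>additive_group\<^esub>"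
    using assms(2) by (simp add: numeral_2_eq_2 nat_pow_def additive_group_def)
  then have "ord x dvd 2" using pow_eq_id[of x 2] carr by simp
  moreover have "ord x dvd card (UNIV :: 'a set)"
    using ord_dvd_group_order[of x] carr by (simp add: order_def)
  ultimately have "ord x = 1"
    using assms(1) by (metis One_nat_def dvd_trans prime_nat_iff two_is_prime_nat)
  then show ?thesis using ord_eq_1[of x] carr by (simp add: additive_group_def)
qed

text \<open>An isomorphism onto the product of the cyclic groups of orders \<open>ns\<close>, with values taken as integer
  representatives in \<open>{0..<n}\<close>: the atom criterion below adds up these representatives without
  reducing them.\<close>

definition coordinates :: "nat list \<Rightarrow> ('a::ab_group_add \<Rightarrow> nat \<Rightarrow> int) \<Rightarrow> bool" where
  "coordinates ns h \<longleftrightarrow>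
    (\<forall>x. \<forall>i < length ns. 0 \<le> h x i \<and> h x i < int (ns ! i)) \<and>
    (\<forall>x y. \<forall>i < length ns. h (x + y) i = (h x i + h y i) mod int (ns ! i)) \<and>
    (\<forall>x y. (\<forall>i < length ns. h x i = h y i) \<longrightarrow> x = y) \<and>
    (\<forall>v. (\<forall>i < length ns. 0 \<le> v i \<and> v i < int (ns ! i)) \<longrightarrow> (\<exists>x. \<forall>i < length ns. h x i = v i))"

lemma invariant_factors_coordinates:
  assumes "invariant_factors TYPE('a::{ab_group_add, finite}) ns"
  obtains h :: "'a::{ab_group_add, finite} \<Rightarrow> nat \<Rightarrow> int" where "coordinates ns h"
proof -
  let ?G = "additive_group :: 'a monoid"
  let ?P = "product_group {..<length ns} (\<lambda>i. integer_mod_group (ns ! i))"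
  have "\<forall>n \<in> set ns. 1 < n" using assms unfolding invariant_factors_def by blast
  then have pos: "0 < ns ! i" if "i < length ns" for i
    using that nth_mem by fastforce
  obtain h where h: "h \<in> iso ?G ?P"
    using assms unfolding invariant_factors_def is_iso_def by blast
  have hom: "h \<in> hom ?G ?P" and bij: "bij_betw h UNIV (carrier ?P)"
    using h by (auto simp: iso_def additive_group_def)
  have carr: "carrier ?P = (\<Pi>\<^sub>E i\<in>{..<length ns}. {0..<int (ns ! i)})"
    unfolding carrier_product_group
    by (rule PiE_cong) (use pos in \<open>simp add: carrier_integer_mod_group gr0_conv_Suc\<close>)
  have range: "h x \<in> carrier ?P" for x using bij by (auto simp: bij_betw_def)
  have 1: "\<forall>x. \<forall>i < length ns. 0 \<le> h x i \<and> h x i < int (ns ! i)"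
    using range unfolding carr by (auto simp: PiE_iff)
  have 2: "\<forall>x y. \<forall>i < length ns. h (x + y) i = (h x i + h y i) mod int (ns ! i)"
  proof (intro allI impI)
    fix x y i assume i: "i < length ns"
    have "h (x + y) = h x \<otimes>\<^bsub>?P\<^esub> h y"
      using hom_mult[OF hom, of x y] by (simp add: additive_group_def)
    then show "h (x + y) i = (h x i + h y i) mod int (ns ! i)"
      using i by (simp add: mult_product_group mult_integer_mod_group)
  qed
  have 3: "\<forall>x y. (\<forall>i < length ns. h x i = h y i) \<longrightarrow> x = y"
  proof (intro allI impI)
    fix x y assume eq: "\<forall>i < length ns. h x i = h y i"
    have "h x = h y"
      using range[of x] range[of y] eq unfolding carr by (auto intro: PiE_ext)
    then show "x = y" using bij by (auto simp: bij_betw_def inj_on_def)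
  qed
  have 4: "\<forall>v. (\<forall>i < length ns. 0 \<le> v i \<and> v i < int (ns ! i)) \<longrightarrow> (\<exists>x. \<forall>i < length ns. h x i = v i)"
  proof (intro allI impI)
    fix v assume v: "\<forall>i < length ns. 0 \<le> v i \<and> v i < int (ns ! i)"
    then have "restrict v {..<length ns} \<in> carrier ?P" unfolding carr by auto
    then have "restrict v {..<length ns} \<in> range h"
      using bij unfolding bij_betw_def by blast
    then obtain x where x: "h x = restrict v {..<length ns}" by (metis rangeE)
    have "\<forall>i < length ns. h x i = v i" unfolding x by simp
    then show "\<exists>x. \<forall>i < length ns. h x i = v i" by blast
  qed
  show thesis by (rule that[of h]) (use 1 2 3 4 in \<open>simp add: coordinates_def\<close>)
qed

lemma coordinates_zero:
  assumes "coordinates ns h" and "i < length ns"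
  shows "h 0 i = 0"
proof -
  have r: "0 \<le> h 0 i" "h 0 i < int (ns ! i)" and "h (0 + 0) i = (h 0 i + h 0 i) mod int (ns ! i)"
    using assms unfolding coordinates_def by blast+
  then have "(h 0 i + h 0 i) mod int (ns ! i) = h 0 i mod int (ns ! i)" by simp
  then have "int (ns ! i) dvd h 0 i" by (simp add: mod_eq_dvd_iff)
  then show ?thesis using r by (meson zdvd_imp_le less_le_not_le order_le_less)
qed

lemma coordinates_sum_mset:
  assumes "coordinates ns h" and "i < length ns"
  shows "h (\<Sum>\<^sub># A) i = (\<Sum>x\<in>#A. h x i) mod int (ns ! i)"
proof (induction A)
  case empty
  then show ?case using coordinates_zero[OF assms] by simp
next
  case (add x A)
  have "h (x + \<Sum>\<^sub># A) i = (h x i + h (\<Sum>\<^sub># A) i) mod int (ns ! i)"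
    using assms unfolding coordinates_def by blast
  then show ?case using add.IH by (simp add: mod_simps)
qed

text \<open>Suppose \<open>U = S + T\<close> with both parts having a vanishing signed sum, and fix a coordinate with
  modulus \<open>n\<close>. The unsigned coordinate sums of \<open>S\<close> and \<open>T\<close> are nonnegative and add up to \<open>n\<close>. A
  signed coordinate sum has the parity of the unsigned one and at most its absolute value, and it
  is divisible by \<open>n\<close>: so the unsigned sum is even or equal to \<open>n\<close>. As \<open>n\<close> is odd, not both parts
  can have an even sum, hence one of them has sum \<open>n\<close> and the other has sum 0. All coordinates
  of \<open>e\<close> are positive, so the part without this occurrence of \<open>e\<close> has sum 0 in every coordinate.
  It thus consists of zeros, and is empty.\<close>

lemma coordinates_pm_atom:
  assumes coord: "coordinates ns h" and odd: "\<forall>i < length ns. odd (ns ! i)"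
    and total: "\<forall>i < length ns. (\<Sum>x\<in>#U. h x i) = int (ns ! i)"
    and e: "e \<in># U" "\<forall>i < length ns. 0 < h e i" and nz: "0 \<notin># U"
  shows "U \<in> atoms pm_zero_sum_monoid"
proof (rule pm_atomI)
  define f where "f i S = (\<Sum>x\<in>#S. h x i)" for i S
  have f_add: "f i (S + T) = f i S + f i T" for i S T by (simp add: f_def)
  have h_nonneg: "0 \<le> h x i" if "i < length ns" for i x
    using coord that unfolding coordinates_def by blast
  have f_nonneg: "0 \<le> f i S" if "i < length ns" for i S
    unfolding f_def by (induction S) (auto simp: h_nonneg[OF that])
  have f_ge: "h x i \<le> f i S" if i: "i < length ns" and x: "x \<in># S" for i x S
  proof -
    obtain T where T: "S = add_mset x T" using x by (meson multi_member_split)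
    then show ?thesis using f_nonneg[OF i, of T] by (simp add: f_def)
  qed
  have even_or_full: "even (f i S) \<or> f i S = int (ns ! i)"
    if i: "i < length ns" and S: "0 \<in> signed_sums S" "f i S \<le> int (ns ! i)" for i S
  proof -
    obtain A B where AB: "S = A + B" "\<Sum>\<^sub># A = \<Sum>\<^sub># B"
      using S(1) by (auto simp: signed_sums_def)
    have "f i A mod int (ns ! i) = f i B mod int (ns ! i)"
      using coordinates_sum_mset[OF coord i] AB(2) by (metis f_def)
    then have "int (ns ! i) dvd f i A - f i B" by (simp add: mod_eq_dvd_iff)
    then obtain q where q: "f i A - f i B = int (ns ! i) * q" by blast
    have bounds: "0 \<le> f i A" "0 \<le> f i B" "f i A + f i B \<le> int (ns ! i)"
      using f_nonneg[OF i] S(2) AB(1) f_add by auto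
    have pos: "0 < int (ns ! i)" using odd i by (metis dvd_0_right gr0I of_nat_0_less_iff)
    have "int (ns ! i) * q \<le> int (ns ! i) * 1" "int (ns ! i) * (-1) \<le> int (ns ! i) * q"
      using q bounds by linarith+
    then have "q \<le> 1" "-1 \<le> q" using pos by (simp_all only: mult_le_cancel_left_pos)
    then have "q = 0 \<or> q = 1 \<or> q = -1" by linarith
    then show ?thesis using q bounds unfolding AB(1) f_add by auto
  qed
  have vanish: "f i S = 0 \<or> f i T = 0"
    if "i < length ns" "0 \<in> signed_sums S" "0 \<in> signed_sums T" "U = S + T" for i S T
  proof -
    have sum: "f i S + f i T = int (ns ! i)"
      using total that(1,4) f_add by (simp add: f_def)
    moreover have "f i S \<le> int (ns ! i)" "f i T \<le> int (ns ! i)"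
      using sum f_nonneg[OF that(1)] by (smt (verit))+
    moreover have "odd (int (ns ! i))" using odd that(1) by simp
    ultimately show ?thesis
      using even_or_full[OF that(1), of S] even_or_full[OF that(1), of T] that(2,3)
      by (smt (verit) even_add)
  qed
  have rest_empty: "T = {#}"
    if ST: "0 \<in> signed_sums S" "0 \<in> signed_sums T" "U = S + T" "e \<in># S" for S T
  proof (rule ccontr)
    assume "T \<noteq> {#}"
    then obtain x where x: "x \<in># T" by blast
    have "h x i = h 0 i" if i: "i < length ns" for i
    proof -
      have "0 < h e i" using e(2) i by blast
      then have "f i S \<noteq> 0" using f_ge[OF i ST(4)] by linarith
      then have "f i T = 0" using vanish[OF i ST(1-3)] by blast
      then show ?thesis
        using f_ge[OF i x] h_nonneg[OF i, of x] coordinates_zero[OF coord i] by linarith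
    qed
    then have "x = 0" using coord unfolding coordinates_def by blast
    then show False using x nz ST(3) by simp
  qed
  show "S = {#} \<or> T = {#}" if "0 \<in> signed_sums S" "0 \<in> signed_sums T" "U = S + T" for S T
    using rest_empty[of S T] rest_empty[of T S] that e(1) by (auto simp: union_commute)
  have "h (\<Sum>\<^sub># U) i = h 0 i" if "i < length ns" for i
    using coordinates_sum_mset[OF coord that] coordinates_zero[OF coord that] total that by simp
  then have "\<Sum>\<^sub># U = 0" using coord unfolding coordinates_def by blast
  then show "0 \<in> signed_sums U"
    unfolding signed_sums_def by (intro CollectI exI[of _ U] exI[of _ "{#}"]) simp
  show "U \<noteq> {#}" using e(1) by auto
qed

lemma sum_mset_sum_lessThan:
  fixes g :: "'a \<Rightarrow> 'b::comm_monoid_add"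
  shows "(\<Sum>x\<in>#(\<Sum>i<(r::nat). M i). g x) = (\<Sum>i<r. \<Sum>x\<in>#M i. g x)"
  by (induction r) auto

text \<open>The atom consists of the basis elements \<open>b i\<close>, each repeated one time less than its order, and
  their sum \<open>e\<close>, so every coordinate sum is the corresponding invariant factor. These are odd
  because otherwise half of one would give an element of order 2.\<close>

lemma invariant_factors_pm_atom:
  assumes odd_card: "odd (card (UNIV :: 'a::{ab_group_add, finite} set))"
    and inv: "invariant_factors TYPE('a) ns" and "ns \<noteq> []"
  obtains e :: "'a::{ab_group_add, finite}" and W where "add_mset e (W + W) \<in> atoms pm_zero_sum_monoid"
    and "1 + 2 * size W = 1 + (\<Sum>n\<leftarrow>ns. n - 1)"
proof -
  obtain h :: "'a \<Rightarrow> nat \<Rightarrow> int" where coord: "coordinates ns h"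
    using invariant_factors_coordinates[OF inv] .
  have gt1: "1 < ns ! i" if "i < length ns" for i
    using inv that by (simp add: invariant_factors_def)
  have ex: "\<exists>x. \<forall>i < length ns. h x i = v i" if "\<And>i. i < length ns \<Longrightarrow> 0 \<le> v i \<and> v i < int (ns ! i)" for v
    using coord that unfolding coordinates_def by blast
  have odd: "odd (ns ! i)" if i: "i < length ns" for i
  proof
    assume even: "even (ns ! i)"
    obtain t where t: "\<forall>j < length ns. h t j = (if j = i then int (ns ! i) div 2 else 0)"
      using ex[of "\<lambda>j. if j = i then int (ns ! i) div 2 else 0"] gt1 by force
    have "h (t + t) j = h 0 j" if j: "j < length ns" for j
    proof -
      have "h (t + t) j = (h t j + h t j) mod int (ns ! j)"
        using coord j unfolding coordinates_def by blast
      then show ?thesis using t j even coordinates_zero[OF coord j] by auto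
    qed
    then have "t + t = 0" using coord unfolding coordinates_def by blast
    then have "h t i = 0" using odd_card_double_eq_0[OF odd_card] coordinates_zero[OF coord i] by blast
    then show False using t i gt1[OF i] even by auto
  qed
  obtain e where e: "\<forall>i < length ns. h e i = 1"
    using ex[of "\<lambda>_. 1"] gt1 by force
  have "\<forall>i. \<exists>x. \<forall>j < length ns. h x j = (if j = i then 1 else 0)"
  proof
    fix i show "\<exists>x. \<forall>j < length ns. h x j = (if j = i then 1 else 0)"
      by (rule ex) (use gt1 in force)
  qed
  then obtain b where b: "\<And>i j. j < length ns \<Longrightarrow> h (b i) j = (if j = i then 1 else 0)"
    by metis
  define W where "W = (\<Sum>i<length ns. replicate_mset ((ns ! i - 1) div 2) (b i))"
  have half: "2 * ((ns ! i - 1) div 2) = ns ! i - 1" if "i < length ns" for i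
    using odd[OF that] by simp
  have "size W = (\<Sum>i<length ns. (ns ! i - 1) div 2)"
    unfolding W_def by (induction "length ns") auto
  then have "2 * size W = (\<Sum>i<length ns. ns ! i - 1)"
    using half by (auto simp only: sum_distrib_left lessThan_iff intro!: sum.cong)
  also have "\<dots> = (\<Sum>n\<leftarrow>ns. n - 1)"
    by (simp add: sum_list_sum_nth atLeast0LessThan)
  finally have size: "1 + 2 * size W = 1 + (\<Sum>n\<leftarrow>ns. n - 1)" by simp
  have coord_W: "(\<Sum>x\<in>#W. h x j) = int ((ns ! j - 1) div 2)" if j: "j < length ns" for j
  proof -
    have "(\<Sum>x\<in>#W. h x j) = (\<Sum>i<length ns. int ((ns ! i - 1) div 2) * h (b i) j)"
      unfolding W_def sum_mset_sum_lessThan by simp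
    also have "\<dots> = (\<Sum>i<length ns. if i = j then int ((ns ! i - 1) div 2) else 0)"
      by (intro sum.cong) (auto simp: b[OF j])
    also have "\<dots> = int ((ns ! j - 1) div 2)" using j by simp
    finally show ?thesis .
  qed
  have "add_mset e (W + W) \<in> atoms pm_zero_sum_monoid"
  proof (rule coordinates_pm_atom[OF coord])
    show "\<forall>i < length ns. odd (ns ! i)" using odd by blast
    show "\<forall>i < length ns. (\<Sum>x\<in>#add_mset e (W + W). h x i) = int (ns ! i)"
    proof (intro allI impI)
      fix i assume i: "i < length ns"
      have "(\<Sum>x\<in>#add_mset e (W + W). h x i) = 1 + int (2 * ((ns ! i - 1) div 2))"
        using e i coord_W[OF i] by simp
      also have "\<dots> = int (ns ! i)" using half[OF i] gt1[OF i] by simp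
      finally show "(\<Sum>x\<in>#add_mset e (W + W). h x i) = int (ns ! i)" .
    qed
    show "e \<in># add_mset e (W + W)" by simp
    show "\<forall>i < length ns. 0 < h e i" using e by simp
    have "e \<noteq> 0" using e coordinates_zero[OF coord, of 0] \<open>ns \<noteq> []\<close> by auto
    moreover have "b i \<noteq> 0" if "i < length ns" for i
      using b[OF that, of i] coordinates_zero[OF coord that] by auto
    moreover have "\<exists>i < length ns. x = b i" if "x \<in># W" for x
      using that unfolding W_def by (auto simp: set_mset_sum split: if_splits)
    ultimately show "0 \<notin># add_mset e (W + W)" by (metis insert_iff set_mset_add_mset_insert union_iff)
  qed
  then show thesis using size by (rule that)
qed

text \<open>The atoms just constructed bound all the numbers in the supremum that defines \<open>davenport_star\<close>
  by the Davenport constant. Hence the supremum is attained, by an actual list of invariant factors.\<close>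

lemma davenport_pm_atom:
  assumes odd_card: "odd (card (UNIV :: 'a::{ab_group_add, finite} set))"
    and eq: "davenport TYPE('a) = davenport_star TYPE('a)" and ge: "3 \<le> davenport_star TYPE('a)"
  obtains e :: "'a::{ab_group_add, finite}" and W where "add_mset e (W + W) \<in> atoms pm_zero_sum_monoid"
    and "1 + 2 * size W = davenport TYPE('a)"
proof -
  let ?D = "{1 + (\<Sum>n\<leftarrow>ns. n - 1) | ns. invariant_factors TYPE('a) ns}"
  have "n \<le> davenport TYPE('a)" if "n \<in> ?D" for n
  proof -
    obtain ns where ns: "invariant_factors TYPE('a) ns" "n = 1 + (\<Sum>n\<leftarrow>ns. n - 1)"
      using \<open>n \<in> ?D\<close> by blast
    show ?thesis
    proof (cases "ns = []")
      case True
      then show ?thesis using ns(2) eq ge by simp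
    next
      case False
      obtain e :: 'a and W where "add_mset e (W + W) \<in> atoms pm_zero_sum_monoid"
        "1 + 2 * size W = n"
        using invariant_factors_pm_atom[OF odd_card ns(1) False] ns(2) by metis
      then show ?thesis using pm_atom_size_le_davenport by fastforce
    qed
  qed
  then have fin: "finite ?D" by (meson finite_nat_set_iff_bounded_le)
  have "?D \<noteq> {}"
  proof
    assume "?D = {}"
    then have "davenport_star TYPE('a) = 0" unfolding davenport_star_def Sup_nat_def by simp
    then show False using ge by simp
  qed
  then have "davenport_star TYPE('a) \<in> ?D"
    using Max_in[OF fin] unfolding davenport_star_def by (simp add: Sup_nat_def)
  then obtain ns where ns: "invariant_factors TYPE('a) ns" "davenport_star TYPE('a) = 1 + (\<Sum>n\<leftarrow>ns. n - 1)"
    by blast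
  then have "ns \<noteq> []" using ge by auto
  then show thesis using invariant_factors_pm_atom[OF odd_card ns(1)] that ns(2) eq by metis
qed

section \<open>Lengths of factorizations\<close>

lemma length_set_zero: "0 \<in> length_set pm_zero_sum_monoid {#}"
  by (simp add: pm_zero_sum_monoid_eq length_set_sequence_monoid)

lemma length_set_atom:
  "A \<in> atoms pm_zero_sum_monoid \<Longrightarrow> 1 \<in> length_set pm_zero_sum_monoid A"
  unfolding pm_zero_sum_monoid_eq length_set_sequence_monoid
  by (rule exI[of _ "[A]"]) simp

lemma length_set_add:
  assumes "m \<in> length_set pm_zero_sum_monoid S" and "n \<in> length_set pm_zero_sum_monoid T"
  shows "m + n \<in> length_set pm_zero_sum_monoid (S + T)"
proof -
  from assms obtain as bs where
    "length as = m" "set as \<subseteq> atoms pm_zero_sum_monoid" "sum_list as = S"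
    "length bs = n" "set bs \<subseteq> atoms pm_zero_sum_monoid" "sum_list bs = T"
    unfolding pm_zero_sum_monoid_eq length_set_sequence_monoid by blast
  then show ?thesis
    unfolding pm_zero_sum_monoid_eq length_set_sequence_monoid
    by (intro exI[of _ "as @ bs"]) auto
qed

lemma length_set_signed_sums:
  assumes "n \<in> length_set pm_zero_sum_monoid S"
  shows "0 \<in> signed_sums S"
proof -
  obtain as where as: "set as \<subseteq> atoms pm_zero_sum_monoid" "sum_list as = S"
    using assms unfolding pm_zero_sum_monoid_eq length_set_sequence_monoid by blast
  have "0 \<in> signed_sums (sum_list as)"
    using as(1) by (induction as) (auto intro: zero_signed_sums_union pm_atomD(1))
  then show ?thesis using as(2) by simp
qed

lemma length_set_square:
  assumes "0 \<notin># W"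
  shows "size W \<in> length_set pm_zero_sum_monoid (W + W)"
  using assms
proof (induction W)
  case empty
  then show ?case using length_set_zero by simp
next
  case (add g W)
  have "{#g, g#} \<in> atoms pm_zero_sum_monoid"
    using add.prems by (intro pm_atomI_size_le_3) (auto simp: signed_sums_add_mset)
  then have "1 + size W \<in> length_set pm_zero_sum_monoid ({#g, g#} + (W + W))"
    using add by (intro length_set_add length_set_atom) auto
  then show ?case by simp
qed

text \<open>The quantity \<open>size S + count S 0\<close> is additive. Counting zeros twice makes the atom \<open>0\<close> weigh
  the same as the other shortest atoms, so each atom contributes at least 2 and at most the
  Davenport constant.\<close>

lemma length_set_bounds:
  fixes S :: "'a::{ab_group_add, finite} multiset"
  assumes "m \<in> length_set pm_zero_sum_monoid S" and "2 \<le> davenport TYPE('a)"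
  shows "2 * m \<le> size S + count S 0" and "size S + count S 0 \<le> m * davenport TYPE('a)"
proof -
  obtain as where as: "length as = m" "set as \<subseteq> atoms pm_zero_sum_monoid" "sum_list as = S"
    using assms unfolding pm_zero_sum_monoid_eq length_set_sequence_monoid by blast
  have atom: "2 \<le> size A + count A 0 \<and> size A + count A 0 \<le> davenport TYPE('a)"
    if A: "A \<in> atoms pm_zero_sum_monoid" for A :: "'a multiset"
  proof (cases "0 \<in># A")
    case True
    then show ?thesis using pm_atom_with_zero[OF A] assms(2) by simp
  next
    case False
    then show ?thesis
      using zero_signed_sums_size_ge_2[OF pm_atomD(1,2)[OF A]] pm_atom_size_le_davenport[OF A]
      by (simp add: not_in_iff)
  qed
  have "2 * length as \<le> size (sum_list as) + count (sum_list as) 0 \<and>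
      size (sum_list as) + count (sum_list as) 0 \<le> length as * davenport TYPE('a)"
    using as(2) by (induction as) (use atom in fastforce)+
  then show "2 * m \<le> size S + count S 0" "size S + count S 0 \<le> m * davenport TYPE('a)"
    using as by auto
qed

lemma length_union_iff:
  "m \<in> length_union k (pm_zero_sum_monoid :: 'a::ab_group_add multiset monoid) \<longleftrightarrow>
    (\<exists>S :: 'a multiset. k \<in> length_set pm_zero_sum_monoid S \<and> m \<in> length_set pm_zero_sum_monoid S)"
proof -
  have "S \<in> carrier pm_zero_sum_monoid" if "k \<in> length_set pm_zero_sum_monoid S" for S :: "'a multiset"
    using length_set_signed_sums[OF that] by (simp add: pm_zero_sum_monoid_eq sequence_monoid_def)
  then show ?thesis
    unfolding length_union_def length_system_def by blast
qed

lemma length_union_sym: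
  "m \<in> length_union k (pm_zero_sum_monoid :: 'a::ab_group_add multiset monoid) \<longleftrightarrow>
    k \<in> length_union m (pm_zero_sum_monoid :: 'a multiset monoid)"
  unfolding length_union_iff by blast

lemma length_union_add:
  fixes k l m n :: nat
  assumes "m \<in> length_union k (pm_zero_sum_monoid :: 'a::ab_group_add multiset monoid)"
    and "n \<in> length_union l (pm_zero_sum_monoid :: 'a multiset monoid)"
  shows "m + n \<in> length_union (k + l) (pm_zero_sum_monoid :: 'a multiset monoid)"
  using assms unfolding length_union_iff by (meson length_set_add)

lemma length_union_1: "1 \<in> length_union 1 (pm_zero_sum_monoid :: 'a::ab_group_add multiset monoid)"
  unfolding length_union_iff using length_set_atom[OF zero_pm_atom] by blast

lemma pm_atom_size_in_length_union_2:
  fixes A :: "'a::ab_group_add multiset"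
  assumes "A \<in> atoms pm_zero_sum_monoid" and "2 \<le> size A"
  shows "size A \<in> length_union 2 (pm_zero_sum_monoid :: 'a multiset monoid)"
proof -
  have "0 \<notin># A" using pm_atom_with_zero[OF assms(1)] assms(2) by force
  then have "size A \<in> length_set pm_zero_sum_monoid (A + A)" by (rule length_set_square)
  moreover have "2 \<in> length_set pm_zero_sum_monoid (A + A)"
    using length_set_add[OF length_set_atom length_set_atom, OF assms(1) assms(1)]
    by (simp add: numeral_2_eq_2)
  ultimately show ?thesis unfolding length_union_iff by blast
qed

lemma signed_sums_image_mset:
  fixes \<phi> :: "'a::ab_group_add \<Rightarrow> 'b::ab_group_add"
  assumes "\<And>x y. \<phi> (x + y) = \<phi> x + \<phi> y" and "inj \<phi>"
  shows "0 \<in> signed_sums (image_mset \<phi> S) \<longleftrightarrow> 0 \<in> signed_sums S"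
proof -
  have diff: "\<phi> (x - y) = \<phi> x - \<phi> y" for x y
    using assms(1)[of "x - y" y] by (simp add: algebra_simps)
  have "\<phi> x \<in> signed_sums (image_mset \<phi> S) \<longleftrightarrow> x \<in> signed_sums S" for x
  proof (induction S arbitrary: x)
    case empty
    have "\<phi> 0 = 0" using diff[of 0 0] by simp
    then show ?case using inj_eq[OF assms(2), of x 0] by simp
  next
    case (add g S)
    show ?case
      using add.IH[of "x - g"] add.IH[of "x + g"]
      by (simp add: signed_sums_add_mset assms(1) diff)
  qed
  from this[of 0] show ?thesis using diff[of 0 0] by simp
qed

lemma pm_atom_image_mset:
  fixes \<phi> :: "'a::ab_group_add \<Rightarrow> 'b::ab_group_add"
  assumes "\<And>x y. \<phi> (x + y) = \<phi> x + \<phi> y" and "inj \<phi>" and "A \<in> atoms pm_zero_sum_monoid"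
  shows "image_mset \<phi> A \<in> atoms pm_zero_sum_monoid"
proof (rule pm_atomI)
  note iff = signed_sums_image_mset[of \<phi>, OF assms(1,2)]
  show "0 \<in> signed_sums (image_mset \<phi> A)" using pm_atomD(1)[OF assms(3)] iff by blast
  show "image_mset \<phi> A \<noteq> {#}" using pm_atomD(2)[OF assms(3)] by simp
  fix B C assume BC: "0 \<in> signed_sums B" "0 \<in> signed_sums C" "image_mset \<phi> A = B + C"
  from image_mset_eq_plusD[OF BC(3)] obtain B' C' where
    BC': "A = B' + C'" "B = image_mset \<phi> B'" "C = image_mset \<phi> C'" by blast
  then have "0 \<in> signed_sums B'" "0 \<in> signed_sums C'" using BC(1,2) iff by blast+
  then show "B = {#} \<or> C = {#}" using pm_atomD(3)[OF assms(3) _ _ BC'(1)] BC'(2,3) by auto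
qed

text \<open>Both factorizations are of \<open>V V U'\<close>, where \<open>V = e T\<close> and \<open>U'\<close> consists of the doubled terms of
  \<open>e W W\<close>. It is an atom because doubling is an injective endomorphism in odd order. The second
  factorization consists of the atom \<open>e, e, e + e\<close> and one square for each term of \<open>T\<close> and of the
  doubled \<open>W\<close>.\<close>

lemma length_union_3_triple:
  fixes e :: "'a::{ab_group_add, finite}"
  assumes odd_card: "odd (card (UNIV :: 'a set))"
    and U: "add_mset e (W + W) \<in> atoms pm_zero_sum_monoid" "W \<noteq> {#}"
    and V: "add_mset e T \<in> atoms pm_zero_sum_monoid" "T \<noteq> {#}"
  shows "1 + size T + size W \<in> length_union 3 (pm_zero_sum_monoid :: 'a multiset monoid)"
proof -
  define W' where "W' = image_mset (\<lambda>x. x + x) W"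
  have "inj (\<lambda>x :: 'a. x + x)"
  proof (rule injI)
    fix x y :: 'a assume "x + x = y + y"
    then have "(x - y) + (x - y) = 0" by (simp add: algebra_simps)
    then show "x = y" using odd_card_double_eq_0[OF odd_card] by (metis eq_iff_diff_eq_0)
  qed
  then have "image_mset (\<lambda>x. x + x) (add_mset e (W + W)) \<in> atoms pm_zero_sum_monoid"
    by (intro pm_atom_image_mset U(1)) (simp_all add: ac_simps)
  then have U': "add_mset (e + e) (W' + W') \<in> atoms pm_zero_sum_monoid" by (simp add: W'_def)
  have "W' \<noteq> {#}" using U(2) by (simp add: W'_def)
  then have nz: "0 \<notin># T" "e \<noteq> 0" "0 \<notin># W'" "e + e \<noteq> 0"
    using pm_atom_with_zero[OF V(1)] pm_atom_with_zero[OF U'] V(2) by auto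
  let ?V = "add_mset e T" and ?U = "add_mset (e + e) (W' + W')"
  have "1 + (1 + 1) \<in> length_set pm_zero_sum_monoid (?V + (?V + ?U))"
    by (intro length_set_add length_set_atom V(1) U')
  moreover have "{#e, e, e + e#} \<in> atoms pm_zero_sum_monoid"
    using nz by (intro pm_atomI_size_le_3) (auto simp: signed_sums_add_mset)
  then have "1 + (size T + size W') \<in> length_set pm_zero_sum_monoid ({#e, e, e + e#} + ((T + T) + (W' + W')))"
    by (intro length_set_add length_set_atom length_set_square nz)
  then have "1 + size T + size W \<in> length_set pm_zero_sum_monoid (?V + (?V + ?U))"
    by (simp add: W'_def ac_simps add_mset_commute)
  ultimately show ?thesis
    unfolding length_union_iff by (auto simp: numeral_3_eq_3)
qed

lemma length_union_bounds:
  assumes "2 \<le> davenport TYPE('a::{ab_group_add, finite})"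
    and "m \<in> length_union k (pm_zero_sum_monoid :: 'a multiset monoid)"
  shows "2 * m \<le> k * davenport TYPE('a)"
  using assms length_set_bounds unfolding length_union_iff by (meson order_trans)

text \<open>An element with a factorization of length 1 is an atom, and so has no other length.\<close>

lemma length_union_ge_2:
  assumes "2 \<le> davenport TYPE('a::{ab_group_add, finite})" and "2 \<le> k"
    and "m \<in> length_union k (pm_zero_sum_monoid :: 'a multiset monoid)"
  shows "2 \<le> m"
proof -
  obtain S :: "'a multiset" where S: "k \<in> length_set pm_zero_sum_monoid S" "m \<in> length_set pm_zero_sum_monoid S"
    using assms(3) unfolding length_union_iff by blast
  have "2 * k \<le> m * davenport TYPE('a)"
    using length_union_bounds[OF assms(1)] assms(3) length_union_sym by blast
  then have "m \<noteq> 0" using assms(2) by (cases "m = 0") simp_all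
  moreover have "m \<noteq> 1"
  proof
    assume "m = 1"
    then obtain bs where bs: "length bs = 1" "set bs \<subseteq> atoms pm_zero_sum_monoid" "sum_list bs = S"
      using S(2) unfolding pm_zero_sum_monoid_eq length_set_sequence_monoid by blast
    then have atom: "S \<in> atoms pm_zero_sum_monoid" by (cases bs) auto
    obtain as where as: "length as = k" "set as \<subseteq> atoms pm_zero_sum_monoid" "sum_list as = S"
      using S(1) unfolding pm_zero_sum_monoid_eq length_set_sequence_monoid by blast
    then obtain A B cs where AB: "as = A # B # cs"
      using assms(2) by (metis One_nat_def Suc_1 Suc_le_length_iff)
    have "k - 1 \<in> length_set pm_zero_sum_monoid (B + sum_list cs)"
      using as(1,2) unfolding AB pm_zero_sum_monoid_eq length_set_sequence_monoid
      by (intro exI[of _ "B # cs"]) auto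
    then have "0 \<in> signed_sums (B + sum_list cs)" by (rule length_set_signed_sums)
    moreover have "S = A + (B + sum_list cs)" using as(3) AB by simp
    moreover have "A \<in> atoms pm_zero_sum_monoid" "B \<in> atoms pm_zero_sum_monoid"
      using as(2) AB by auto
    ultimately show False using pm_atomD(3)[OF atom] pm_atomD(1,2) by fastforce
  qed
  ultimately show ?thesis by linarith
qed

text \<open>For \<open>k \<le> m\<close> the value \<open>m\<close> is built up from \<open>k\<close> by splitting off summands 2 of \<open>k\<close>, each linked
  with at most \<open>D\<close>, until 2 or 3 remains. The case \<open>m < k\<close> is the same statement with the two
  numbers exchanged.\<close>

theorem length_union_pm_zero_sum_monoid:
  assumes odd_card: "odd (card (UNIV :: 'a::{ab_group_add, finite} set))"
    and eq: "davenport TYPE('a) = davenport_star TYPE('a)" and ge: "3 \<le> davenport_star TYPE('a)"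
    and "2 \<le> k"
  shows "m \<in> length_union k (pm_zero_sum_monoid :: 'a multiset monoid) \<longleftrightarrow>
    2 \<le> m \<and> 2 * m \<le> k * davenport TYPE('a) \<and> 2 * k \<le> m * davenport TYPE('a)"
proof -
  let ?H = "pm_zero_sum_monoid :: 'a multiset monoid" and ?D = "davenport TYPE('a)"
  have D: "3 \<le> ?D" using eq ge by simp
  obtain e :: 'a and W where U: "add_mset e (W + W) \<in> atoms ?H" and size_W: "1 + 2 * size W = ?D"
    using davenport_pm_atom[OF odd_card eq ge] .
  have "W \<noteq> {#}" using size_W D by auto
  have V: "\<exists>T. size T = t \<and> add_mset e T \<in> atoms ?H" if "1 \<le> t" "t < ?D" for t
    using pm_atoms_of_smaller_size[OF U that(1)] that(2) size_W by simp
  have two: "n \<in> length_union 2 ?H" if n: "2 \<le> n" "n \<le> ?D" for n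
  proof -
    have "1 \<le> n - 1" "n - 1 < ?D" using n by linarith+
    then obtain T where T: "size T = n - 1" "add_mset e T \<in> atoms ?H" using V by blast
    then show ?thesis using pm_atom_size_in_length_union_2[OF T(2)] n by simp
  qed
  have three: "n \<in> length_union 3 ?H" if n: "3 \<le> n" "2 * n \<le> 3 * ?D" for n
  proof (cases "n \<le> ?D + 1")
    case True
    then have "(n - 1) + 1 \<in> length_union (2 + 1) ?H"
      using n(1) by (intro length_union_add two length_union_1) auto
    then show ?thesis using n(1) by simp
  next
    case False
    (* V is to have t + 1 terms, so that the triple and the squares number n. *)
    define t where "t = n - 1 - size W"
    have "1 \<le> t" "t < ?D" "n = 1 + t + size W" using False n size_W unfolding t_def by linarith+
    moreover from this obtain T where T: "size T = t" "add_mset e T \<in> atoms ?H" using V by blast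
    ultimately show ?thesis
      using length_union_3_triple[OF odd_card U \<open>W \<noteq> {#}\<close> T(2)] by fastforce
  qed
  have upward: "n \<in> length_union k ?H" if "2 \<le> k" "k \<le> n" "2 * n \<le> k * ?D" for k n
    using that
  proof (induction k arbitrary: n rule: less_induct)
    case (less k)
    show ?case
    proof (cases "k \<le> 3")
      case True
      then have "k = 2 \<or> k = 3" using less.prems(1) by linarith
      then show ?thesis using two[of n] three[of n] less.prems by auto
    next
      case False
      (* The share of n given to the split-off 2: as much as possible, leaving at least k - 2. *)
      define p where "p = min ?D (n - (k - 2))"
      have kD: "k * ?D = (k - 2) * ?D + 2 * ?D"
        using False by (simp add: diff_mult_distrib)
      have "(k - 2) * 2 \<le> (k - 2) * ?D" using D by (intro mult_le_mono2) linarith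
      then have "2 \<le> p" "p \<le> ?D" "p \<le> n" "k - 2 \<le> n - p" "2 * (n - p) \<le> (k - 2) * ?D"
        using less.prems False D kD unfolding p_def by (auto simp: min_def)
      then have "p + (n - p) \<in> length_union (2 + (k - 2)) ?H"
        using False by (intro length_union_add two less.IH) auto
      then show ?thesis
        by (simp only: le_add_diff_inverse[OF \<open>p \<le> n\<close>] le_add_diff_inverse[OF less.prems(1)])
    qed
  qed
  show ?thesis
  proof
    assume m: "m \<in> length_union k ?H"
    have "2 \<le> ?D" using D by simp
    then show "2 \<le> m \<and> 2 * m \<le> k * ?D \<and> 2 * k \<le> m * ?D"
      using length_union_ge_2[OF _ \<open>2 \<le> k\<close> m] length_union_bounds[OF _ m]
        length_union_bounds[of k m] m length_union_sym by blast
  next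
    assume "2 \<le> m \<and> 2 * m \<le> k * ?D \<and> 2 * k \<le> m * ?D"
    then show "m \<in> length_union k ?H"
      using upward[of k m] upward[of m k] \<open>2 \<le> k\<close> length_union_sym by (metis nat_le_linear)
  qed
qed

theorem theorem6p2:
  fixes k l j :: nat
  assumes "odd (card (UNIV :: 'a::{ab_group_add, finite} set))"
    and "davenport TYPE('a) = davenport_star TYPE('a)"
    and "davenport_star TYPE('a) \<ge> 3"
    and "k = l * davenport TYPE('a) + j"
    and "k \<ge> 2"
    and "j \<in> {0..small_davenport TYPE('a)}"
  shows
    "(j \<in> {2..small_davenport TYPE('a)} \<and> l = 0 \<longrightarrow>
        length_union k (pm_zero_sum_monoid :: 'a multiset monoid)
          = {2..k * davenport TYPE('a) div 2}) \<and>
     (j = 0 \<and> l \<ge> 1 \<longrightarrow>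
        length_union k (pm_zero_sum_monoid :: 'a multiset monoid)
          = {2 * l..k * davenport TYPE('a) div 2}) \<and>
     (real j \<in> {1..real (small_davenport TYPE('a)) / 2} \<and> l \<ge> 1 \<longrightarrow>
        length_union k (pm_zero_sum_monoid :: 'a multiset monoid)
          = {2 * l + 1..k * davenport TYPE('a) div 2}) \<and>
     (real j \<in> {1 + real (small_davenport TYPE('a)) / 2..real (small_davenport TYPE('a))} \<and> l \<ge> 1 \<longrightarrow>
        length_union k (pm_zero_sum_monoid :: 'a multiset monoid)
          = {2 * l + 2..k * davenport TYPE('a) div 2})"
proof -
  let ?H = "pm_zero_sum_monoid :: 'a multiset monoid" and ?D = "davenport TYPE('a)"
  let ?d = "small_davenport TYPE('a)"
  have D: "?D = ?d + 1" "3 \<le> ?D"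
    using davenport_eq_Suc_small_davenport[where 'a = 'a] assms(2,3) by simp_all
  have iff: "m \<in> length_union k ?H \<longleftrightarrow> 2 \<le> m \<and> m \<le> k * ?D div 2 \<and> 2 * k \<le> m * ?D" for m
  proof -
    have "2 * m \<le> k * ?D \<longleftrightarrow> m \<le> k * ?D div 2" by linarith
    then show ?thesis
      using length_union_pm_zero_sum_monoid[OF assms(1-3,5), of m] by blast
  qed
  (* The least admissible a: either a = 2 or a - 1 violates the last inequality of the criterion. *)
  have interval: "length_union k ?H = {a..k * ?D div 2}"
    if a: "2 \<le> a" "2 * k \<le> a * ?D" "a = 2 \<or> (a - 1) * ?D < 2 * k" for a
  proof (rule Set.set_eqI)
    fix m
    have "a \<le> m" if "2 \<le> m" "2 * k \<le> m * ?D"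
    proof (rule ccontr)
      assume "\<not> a \<le> m"
      then have "a \<noteq> 2" "m \<le> a - 1" using that(1) by auto
      then have "m * ?D \<le> (a - 1) * ?D" by (intro mult_le_mono1)
      then show False using a(3) \<open>a \<noteq> 2\<close> that(2) by linarith
    qed
    moreover have "2 * k \<le> m * ?D" if "a \<le> m"
      using a(2) mult_le_mono1[OF that, of ?D] by linarith
    ultimately show "m \<in> length_union k ?H \<longleftrightarrow> m \<in> {a..k * ?D div 2}"
      using iff[of m] a(1) by auto
  qed
  have k2: "2 * k = 2 * l * ?D + 2 * j" using assms(4) by simp
  have j: "j < ?D" using assms(6) D(1) by simp
  show ?thesis
  proof (intro conjI impI; elim conjE)
    assume "l = 0"
    then show "length_union k ?H = {2..k * ?D div 2}"
      using k2 j by (intro interval) auto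
  next
    assume *: "j = 0" "1 \<le> l"
    then obtain l' where "l = Suc l'" by (cases l) auto
    then show "length_union k ?H = {2 * l..k * ?D div 2}"
      using k2 * D(2) by (intro interval) auto
  next
    assume *: "real j \<in> {1..real ?d / 2}" "1 \<le> l"
    then have "1 \<le> j" "2 * j \<le> ?d" by auto
    then show "length_union k ?H = {2 * l + 1..k * ?D div 2}"
      using k2 * D by (intro interval) (auto simp: algebra_simps)
  next
    assume *: "real j \<in> {1 + real ?d / 2..real ?d}" "1 \<le> l"
    then have "2 + ?d \<le> 2 * j" by auto
    then show "length_union k ?H = {2 * l + 2..k * ?D div 2}"
      using k2 j * D by (intro interval) (auto simp: algebra_simps)
  qed
qed

end
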